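(* There exists a constant $C>0$ such that for every $\bar\delta\in(0,1)$ there exists a ReLU DNN $\phi_{\sqrt{},\bar\delta}:\mathbb{R}\to\mathbb{R}$ such that $$\sup_{x\in[0,2]}\bigl|\sqrt{x}-\phi_{\sqrt{},\bar\delta}(x)\bigr|\le\bar\delta$$ and $\mathrm{size}(\phi_{\sqrt{},\bar\delta})\le C\,\lceil\log(\bar\delta^{-1})\rceil^{2}$.
   Context: ReLU DNNs: Let $\sigma(x)=\max\{0,x\}$ for $x\in\mathbb{R}$, applied coordinatewise to vectors. For a depth $L\in\mathbb{N}$, positive integers $N_0,\dots,N_L$, matrices $A^i\in\mathbb{R}^{N_i\times N_{i-1}}$ and vectors $b^i\in\mathbb{R}^{N_i}$ ($i=1,\dots,L$), the associated ReLU DNN is the function $\phi^L:\mathbb{R}^{N_0}\to\mathbb{R}^{N_L}$ given by $\phi^1(x)=A^1x+b^1$ and $\phi^i(x)=A^i\sigma(\phi^{i-1}(x))+b^i$ for $i=2,\dots,L$. Its weights are the entries of $(A^i,b^i)_{i=1,\dots,L}$, and its size, $\mathrm{size}(\phi^L)$, is the number of non-zero weights. A ReLU DNN is identified with the function it realizes. *)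

theory Defs
  imports Complex_Main "HOL-Library.Extended_Real" "Jordan_Normal_Form.Matrix"
begin

text \<open>
  The parameters of a ReLU network with \<open>L\<close> layers are functions of the layer index;
  only the widths at \<open>0, ..., L\<close> and the weights and biases at \<open>1, ..., L\<close> are used.
\<close>

record relu_dnn =
  dnn_depth :: nat
  dnn_width :: "nat \<Rightarrow> nat"
  dnn_weight :: "nat \<Rightarrow> real mat"
  dnn_bias :: "nat \<Rightarrow> real vec"

definition valid_relu_dnn :: "relu_dnn \<Rightarrow> bool" where
  "valid_relu_dnn \<Phi> \<longleftrightarrow>
     1 \<le> dnn_depth \<Phi> \<and>
     (\<forall>i \<in> {0..dnn_depth \<Phi>}. 0 < dnn_width \<Phi> i) \<and>
     (\<forall>i \<in> {1..dnn_depth \<Phi>}.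
        dnn_weight \<Phi> i \<in> carrier_mat (dnn_width \<Phi> i) (dnn_width \<Phi> (i - 1)) \<and>
        dnn_bias \<Phi> i \<in> carrier_vec (dnn_width \<Phi> i))"

definition relu :: "real \<Rightarrow> real" where
  "relu x = max 0 x"

text \<open>
  The case \<open>0\<close> is a dummy that makes the recursion total. The activation is applied between
  consecutive affine maps, neither before the first nor after the last one.
\<close>

fun dnn_layer :: "relu_dnn \<Rightarrow> nat \<Rightarrow> real vec \<Rightarrow> real vec" where
  "dnn_layer \<Phi> 0 x = x"
| "dnn_layer \<Phi> (Suc 0) x = dnn_weight \<Phi> 1 *\<^sub>v x + dnn_bias \<Phi> 1"
| "dnn_layer \<Phi> (Suc (Suc i)) x =
     dnn_weight \<Phi> (Suc (Suc i)) *\<^sub>v map_vec relu (dnn_layer \<Phi> (Suc i) x)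
       + dnn_bias \<Phi> (Suc (Suc i))"

definition dnn_fun :: "relu_dnn \<Rightarrow> real vec \<Rightarrow> real vec" where
  "dnn_fun \<Phi> = dnn_layer \<Phi> (dnn_depth \<Phi>)"

definition dnn_size :: "relu_dnn \<Rightarrow> nat" where
  "dnn_size \<Phi> = (\<Sum>i = 1..dnn_depth \<Phi>.
     card {(r, c). r < dim_row (dnn_weight \<Phi> i) \<and> c < dim_col (dnn_weight \<Phi> i)
                   \<and> dnn_weight \<Phi> i $$ (r, c) \<noteq> 0}
     + card {r. r < dim_vec (dnn_bias \<Phi> i) \<and> dnn_bias \<Phi> i $ r \<noteq> 0})"

text \<open>Networks with one input and one output, identifying the reals with vectors of dimension 1.\<close>

definition scalar_relu_dnn :: "relu_dnn \<Rightarrow> bool" where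
  "scalar_relu_dnn \<Phi> \<longleftrightarrow>
     valid_relu_dnn \<Phi> \<and> dnn_width \<Phi> 0 = 1 \<and> dnn_width \<Phi> (dnn_depth \<Phi>) = 1"

definition scalar_dnn_fun :: "relu_dnn \<Rightarrow> real \<Rightarrow> real" where
  "scalar_dnn_fun \<Phi> x = dnn_fun \<Phi> (vec 1 (\<lambda>_. x)) $ 0"

end

theory Submission
  imports Defs
begin

text \<open>
  It is enough to build a network of bounded width and of depth quadratic in \<open>log (1 / \<delta>)\<close>,
  because a layer of bounded width has a bounded number of weights. Quadratic depth is what an
  iteration for the square root costs if it converges linearly, uniformly up to the singularity at
  \<open>0\<close>, and if each of its steps can be carried out to accuracy \<open>\<delta>\<close> to a constant power in
  logarithmic depth.

  The iteration is Newton's method for \<open>1 / sqrt y\<close>, rewritten so that no division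
  occurs and all quantities stay in the unit interval. Start with \<open>a = y\<close> and
  \<open>d = 1 - y\<close> and repeat
  \<open>a := a (1 + d / 2)\<close>, \<open>d := d\<^sup>2 (3 + d) / 4\<close>. This keeps
  \<open>a\<^sup>2 = y (1 - d)\<close> invariant. With \<open>s = sqrt y\<close> the state is
  \<open>a = s t\<close>, \<open>d = 1 - t\<^sup>2\<close>, where \<open>t\<close> starts at \<open>s\<close> and
  follows \<open>t := t (3 - t\<^sup>2) / 2\<close> towards \<open>1\<close>. The quantity
  \<open>(1 - t) / t\<close> starts below \<open>1 / s\<close> and shrinks by a factor \<open>2 / 3\<close> in
  each step, which gives \<open>s - a \<le> (2 / 3) ^ k\<close> after \<open>k\<close> steps whatever
  \<open>s\<close> is (\<open>newton_ratio_error\<close>).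

  A step is three multiplications. A product is a combination of three squares, and squaring on
  the unit interval is approximated with error \<open>4 ^ (- m)\<close> in depth of order \<open>m\<close> by
  iterating a tent map (\<open>network_computes_square\<close>, \<open>network_computes_product\<close>). One
  step of the iteration magnifies earlier errors by at most \<open>3\<close>, so \<open>k\<close> steps have
  total error at most \<open>3 ^ k / 4 ^ m\<close> (\<open>network_computes_iteration\<close>). With
  \<open>m = k\<close> proportional to \<open>log (1 / \<delta>)\<close> both error sources are of order
  \<open>(3 / 4) ^ k\<close>, and the depth is of order \<open>k\<^sup>2\<close>. The input is halved to lie in
  the unit interval, and the output is multiplied by \<open>sqrt 2\<close>.
\<close>

section \<open>Networks of constant width\<close>

lemma dnn_layer_cong:
  assumes "\<And>j. 1 \<le> j \<Longrightarrow> j \<le> i \<Longrightarrow> dnn_weight \<Phi> j = dnn_weight \<Psi> j \<and> dnn_bias \<Phi> j = dnn_bias \<Psi> j"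
  shows "dnn_layer \<Phi> i x = dnn_layer \<Psi> i x"
  using assms
proof (induction \<Phi> i x rule: dnn_layer.induct)
  case (3 \<Phi> i x)
  then have "dnn_layer \<Phi> (Suc i) x = dnn_layer \<Psi> (Suc i) x"
    by simp
  with "3.prems"[of "Suc (Suc i)"] show ?case
    by simp
qed simp_all

definition append_layer :: "relu_dnn \<Rightarrow> nat \<Rightarrow> real mat \<Rightarrow> real vec \<Rightarrow> relu_dnn" where
  "append_layer \<Phi> w A b = (let L = Suc (dnn_depth \<Phi>) in
     \<lparr>dnn_depth = L, dnn_width = (dnn_width \<Phi>)(L := w),
      dnn_weight = (dnn_weight \<Phi>)(L := A), dnn_bias = (dnn_bias \<Phi>)(L := b)\<rparr>)"

lemma append_layer_sel [simp]:
  "dnn_depth (append_layer \<Phi> w A b) = Suc (dnn_depth \<Phi>)"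
  "dnn_width (append_layer \<Phi> w A b) = (dnn_width \<Phi>)(Suc (dnn_depth \<Phi>) := w)"
  "dnn_weight (append_layer \<Phi> w A b) = (dnn_weight \<Phi>)(Suc (dnn_depth \<Phi>) := A)"
  "dnn_bias (append_layer \<Phi> w A b) = (dnn_bias \<Phi>)(Suc (dnn_depth \<Phi>) := b)"
  by (simp_all add: append_layer_def Let_def)

lemma valid_append_layer:
  assumes "valid_relu_dnn \<Phi>" "0 < w"
    "A \<in> carrier_mat w (dnn_width \<Phi> (dnn_depth \<Phi>))" "b \<in> carrier_vec w"
  shows "valid_relu_dnn (append_layer \<Phi> w A b)"
  using assms by (auto simp: valid_relu_dnn_def le_Suc_eq)

lemma dnn_fun_append_layer:
  assumes "1 \<le> dnn_depth \<Phi>"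
  shows "dnn_fun (append_layer \<Phi> w A b) x = A *\<^sub>v map_vec relu (dnn_fun \<Phi> x) + b"
proof -
  obtain L where L: "dnn_depth \<Phi> = Suc L"
    using assms by (cases "dnn_depth \<Phi>") auto
  have "dnn_layer (append_layer \<Phi> w A b) (Suc L) x = dnn_layer \<Phi> (Suc L) x"
    by (rule dnn_layer_cong) (auto simp: L)
  then show ?thesis
    by (simp add: dnn_fun_def L)
qed

lemma dim_dnn_fun:
  assumes "valid_relu_dnn \<Phi>"
  shows "dim_vec (dnn_fun \<Phi> x) = dnn_width \<Phi> (dnn_depth \<Phi>)"
proof -
  have b: "dim_vec (dnn_bias \<Phi> (dnn_depth \<Phi>)) = dnn_width \<Phi> (dnn_depth \<Phi>)"
    using assms by (auto simp: valid_relu_dnn_def)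
  have "1 \<le> dnn_depth \<Phi>"
    using assms by (simp add: valid_relu_dnn_def)
  then consider "dnn_depth \<Phi> = Suc 0" | i where "dnn_depth \<Phi> = Suc (Suc i)"
    by (metis One_nat_def Suc_le_D not0_implies_Suc)
  then show ?thesis
    using b by cases (simp_all add: dnn_fun_def)
qed

lemma dnn_size_le_widths:
  assumes "valid_relu_dnn \<Phi>"
  shows "dnn_size \<Phi> \<le> (\<Sum>i = 1..dnn_depth \<Phi>. dnn_width \<Phi> i * dnn_width \<Phi> (i - 1) + dnn_width \<Phi> i)"
  unfolding dnn_size_def
proof (intro sum_mono add_mono)
  fix i assume i: "i \<in> {1..dnn_depth \<Phi>}"
  have A: "dnn_weight \<Phi> i \<in> carrier_mat (dnn_width \<Phi> i) (dnn_width \<Phi> (i - 1))"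
    and b: "dnn_bias \<Phi> i \<in> carrier_vec (dnn_width \<Phi> i)"
    using assms i by (auto simp: valid_relu_dnn_def)
  have "card {(r, c). r < dim_row (dnn_weight \<Phi> i) \<and> c < dim_col (dnn_weight \<Phi> i)
          \<and> dnn_weight \<Phi> i $$ (r, c) \<noteq> 0}
      \<le> card ({..<dnn_width \<Phi> i} \<times> {..<dnn_width \<Phi> (i - 1)})"
    using A by (intro card_mono) auto
  then show "card {(r, c). r < dim_row (dnn_weight \<Phi> i) \<and> c < dim_col (dnn_weight \<Phi> i)
          \<and> dnn_weight \<Phi> i $$ (r, c) \<noteq> 0} \<le> dnn_width \<Phi> i * dnn_width \<Phi> (i - 1)"
    by (simp add: card_cartesian_product)
  have "card {r. r < dim_vec (dnn_bias \<Phi> i) \<and> dnn_bias \<Phi> i $ r \<noteq> 0} \<le> card {..<dnn_width \<Phi> i}"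
    using b by (intro card_mono) auto
  then show "card {r. r < dim_vec (dnn_bias \<Phi> i) \<and> dnn_bias \<Phi> i $ r \<noteq> 0} \<le> dnn_width \<Phi> i"
    by simp
qed

text \<open>
  The set \<open>F\<close> collects functions of the scalar input that occur, on \<open>X\<close>, as coordinates of
  the last layer before activation. Leaving their order open makes it
  possible to build networks by naming only the functions that they carry along.
\<close>

definition network_computes ::
  "real set \<Rightarrow> nat \<Rightarrow> nat \<Rightarrow> (real \<Rightarrow> real) set \<Rightarrow> bool" where
  "network_computes X W D F \<longleftrightarrow> (\<exists>\<Phi>. valid_relu_dnn \<Phi> \<and> dnn_depth \<Phi> = D \<and> dnn_width \<Phi> 0 = 1 \<and>
     (\<forall>i\<in>{1..D}. dnn_width \<Phi> i = W) \<and>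
     (\<forall>f\<in>F. \<exists>i<W. \<forall>x\<in>X. dnn_fun \<Phi> (vec 1 (\<lambda>_. x)) $ i = f x))"

lemma network_computes_subset:
  "network_computes X W D F \<Longrightarrow> G \<subseteq> F \<Longrightarrow> network_computes X W D G"
  unfolding network_computes_def by blast

text \<open>
  The functions that one further layer can produce from coordinates \<open>F\<close>. Presenting this affine
  span inductively lets a layer be justified by introduction rules, without writing its matrix.
\<close>

inductive relu_comb :: "real set \<Rightarrow> (real \<Rightarrow> real) set \<Rightarrow> (real \<Rightarrow> real) \<Rightarrow> bool" for X F where
  const: "relu_comb X F (\<lambda>x. c)"
| relu: "f \<in> F \<Longrightarrow> relu_comb X F (\<lambda>x. relu (f x))"
| add: "relu_comb X F g \<Longrightarrow> relu_comb X F h \<Longrightarrow> relu_comb X F (\<lambda>x. g x + h x)"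
| scale: "relu_comb X F g \<Longrightarrow> relu_comb X F (\<lambda>x. c * g x)"
| cong: "relu_comb X F g \<Longrightarrow> (\<And>x. x \<in> X \<Longrightarrow> h x = g x) \<Longrightarrow> relu_comb X F h"

text \<open>Nonnegative coordinates pass through the activation, so they can be kept as registers.\<close>

lemma relu_comb_member:
  assumes "f \<in> F" "\<And>x. x \<in> X \<Longrightarrow> 0 \<le> f x"
  shows "relu_comb X F f"
  by (rule relu_comb.cong[OF relu_comb.relu[OF assms(1)]]) (simp add: assms(2) relu_def)

lemma relu_comb_diff:
  assumes "relu_comb X F g" "relu_comb X F h"
  shows "relu_comb X F (\<lambda>x. g x - h x)"
  by (rule relu_comb.cong[OF relu_comb.add[OF assms(1) relu_comb.scale[OF assms(2), of "-1"]]]) simp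

lemma relu_comb_divide:
  assumes "relu_comb X F g"
  shows "relu_comb X F (\<lambda>x. g x / c)"
  by (rule relu_comb.cong[OF relu_comb.scale[OF assms, of "1 / c"]]) simp

lemmas relu_comb_intros =
  relu_comb.const relu_comb.add relu_comb.scale relu_comb_diff relu_comb_divide

lemma relu_comb_row:
  fixes v :: "real \<Rightarrow> real vec"
  assumes "relu_comb X F g"
    and v: "\<And>x. dim_vec (v x) = W"
    and F: "\<And>f. f \<in> F \<Longrightarrow> \<exists>i<W. \<forall>x\<in>X. v x $ i = f x"
  shows "\<exists>r c. dim_vec r = W \<and> (\<forall>x\<in>X. g x = r \<bullet> map_vec relu (v x) + c)"
  using assms(1)
proof induction
  case (const c)
  show ?case
    by (rule exI[of _ "0\<^sub>v W"], rule exI[of _ c]) (simp add: v carrier_vecI)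
next
  case (relu f)
  then obtain i where i: "i < W" "\<forall>x\<in>X. v x $ i = f x"
    using F by blast
  then show ?case
    by (intro exI[of _ "unit_vec W i"] exI[of _ 0]) (simp add: v carrier_vecI)
next
  case (add g h)
  then obtain r c r' c' where
    r: "dim_vec r = W" "\<forall>x\<in>X. g x = r \<bullet> map_vec relu (v x) + c" and
    r': "dim_vec r' = W" "\<forall>x\<in>X. h x = r' \<bullet> map_vec relu (v x) + c'"
    by blast
  have "(r + r') \<bullet> map_vec relu (v x) = r \<bullet> map_vec relu (v x) + r' \<bullet> map_vec relu (v x)" for x
    by (rule add_scalar_prod_distrib[of _ W]) (simp_all add: carrier_dim_vec r(1) r'(1) v)
  then have "\<forall>x\<in>X. g x + h x = (r + r') \<bullet> map_vec relu (v x) + (c + c')"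
    using r(2) r'(2) by simp
  moreover have "dim_vec (r + r') = W"
    using r' by simp
  ultimately show ?case
    by blast
next
  case (scale g a)
  then obtain r c where r: "dim_vec r = W" "\<forall>x\<in>X. g x = r \<bullet> map_vec relu (v x) + c"
    by blast
  have "(a \<cdot>\<^sub>v r) \<bullet> map_vec relu (v x) = a * (r \<bullet> map_vec relu (v x))" for x
    by (rule smult_scalar_prod_distrib[of _ W]) (simp_all add: carrier_dim_vec r(1) v)
  then have "\<forall>x\<in>X. a * g x = (a \<cdot>\<^sub>v r) \<bullet> map_vec relu (v x) + a * c"
    using r(2) by (simp add: distrib_left)
  moreover have "dim_vec (a \<cdot>\<^sub>v r) = W"
    using r by simp
  ultimately show ?case
    by blast
next
  case (cong g h)
  then obtain r c where "dim_vec r = W" "\<forall>x\<in>X. g x = r \<bullet> map_vec relu (v x) + c"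
    by blast
  then show ?case
    using cong.hyps by (intro exI[of _ r] exI[of _ c]) simp
qed

text \<open>
  Turns row-wise descriptions of finitely many functions into one affine map; rows beyond the
  number of functions are zero, so that the output has exactly \<open>W\<close> coordinates.
\<close>

lemma affine_family_realizable:
  fixes u :: "real \<Rightarrow> real vec"
  assumes G: "finite G" "card G \<le> W"
    and rows: "\<And>g. g \<in> G \<Longrightarrow> \<exists>r c. dim_vec r = N \<and> (\<forall>x\<in>X. g x = r \<bullet> u x + c)"
  shows "\<exists>A b. A \<in> carrier_mat W N \<and> b \<in> carrier_vec W \<and>
           (\<forall>g\<in>G. \<exists>i<W. \<forall>x\<in>X. (A *\<^sub>v u x + b) $ i = g x)"
proof -
  obtain r c where rc: "\<And>g. g \<in> G \<Longrightarrow> dim_vec (r g) = N \<and> (\<forall>x\<in>X. g x = r g \<bullet> u x + c g)"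
    using rows by metis
  obtain e where e: "bij_betw e {0..<card G} G"
    using ex_bij_betw_nat_finite[OF G(1)] by blast
  define R where "R i = (if i < card G then r (e i) else 0\<^sub>v N)" for i
  define A where "A = mat\<^sub>r W N R"
  define b where "b = vec W (\<lambda>i. c (e i))"
  have dimR: "dim_vec (R i) = N" for i
    using rc e bij_betwE by (fastforce simp: R_def)
  have "\<exists>i<W. \<forall>x\<in>X. (A *\<^sub>v u x + b) $ i = g x" if "g \<in> G" for g
  proof -
    have "g \<in> e ` {0..<card G}"
      using that by (simp add: bij_betw_imp_surj_on[OF e])
    then obtain i where i: "i < card G" "e i = g"
      by auto
    have "i < W"
      using i(1) G(2) by simp
    then have "row A i = R i" "dim_row A = W"
      unfolding A_def by (simp_all add: row_mat_of_row_fun dimR)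
    then have "(A *\<^sub>v u x + b) $ i = R i \<bullet> u x + c g" for x
      using \<open>i < W\<close> i(2) by (simp add: b_def)
    then show ?thesis
      using i \<open>i < W\<close> rc[OF that] by (intro exI[of _ i]) (simp add: R_def)
  qed
  moreover have "A \<in> carrier_mat W N" "b \<in> carrier_vec W"
    by (simp_all add: A_def b_def)
  ultimately show ?thesis
    by blast
qed

lemma network_computes_affine:
  assumes "finite G" "card G \<le> W" "0 < W"
    and affine: "\<And>g. g \<in> G \<Longrightarrow> \<exists>w c. \<forall>x\<in>X. g x = w * x + c"
  shows "network_computes X W 1 G"
proof -
  have "\<exists>r c. dim_vec r = 1 \<and> (\<forall>x\<in>X. g x = r \<bullet> vec 1 (\<lambda>_. x) + c)" if g: "g \<in> G" for g
  proof -
    obtain w c where wc: "\<forall>x\<in>X. g x = w * x + c"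
      using affine[OF g] by blast
    show ?thesis
      by (intro exI[of _ "vec 1 (\<lambda>_. w)"] exI[of _ c]) (use wc in \<open>simp add: scalar_prod_def\<close>)
  qed
  from affine_family_realizable[OF assms(1,2) this]
  obtain A b where Ab: "A \<in> carrier_mat W 1" "b \<in> carrier_vec W"
    "\<forall>g\<in>G. \<exists>i<W. \<forall>x\<in>X. (A *\<^sub>v vec 1 (\<lambda>_. x) + b) $ i = g x"
    by blast
  define \<Phi> where "\<Phi> = \<lparr>dnn_depth = 1, dnn_width = (\<lambda>i. if i = 0 then 1 else W),
    dnn_weight = (\<lambda>_. A), dnn_bias = (\<lambda>_. b)\<rparr>"
  show ?thesis
    unfolding network_computes_def
    by (intro exI[of _ \<Phi>]) (use Ab assms(3) in \<open>auto simp: \<Phi>_def valid_relu_dnn_def dnn_fun_def\<close>)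
qed

lemma network_computes_Suc:
  assumes "network_computes X W D F" "finite G" "card G \<le> W"
    and comb: "\<And>g. g \<in> G \<Longrightarrow> relu_comb X F g"
  shows "network_computes X W (Suc D) G"
proof -
  obtain \<Phi> where \<Phi>: "valid_relu_dnn \<Phi>" "dnn_depth \<Phi> = D" "dnn_width \<Phi> 0 = 1"
    "\<forall>i\<in>{1..D}. dnn_width \<Phi> i = W"
    "\<forall>f\<in>F. \<exists>i<W. \<forall>x\<in>X. dnn_fun \<Phi> (vec 1 (\<lambda>_. x)) $ i = f x"
    using assms(1) unfolding network_computes_def by blast
  have D: "1 \<le> D" and width: "dnn_width \<Phi> D = W" and W: "0 < W"
    using \<Phi> by (force simp: valid_relu_dnn_def)+
  have "\<exists>r c. dim_vec r = W \<and>
      (\<forall>x\<in>X. g x = r \<bullet> map_vec relu (dnn_fun \<Phi> (vec 1 (\<lambda>_. x))) + c)" if "g \<in> G" for g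
    by (rule relu_comb_row[OF comb[OF that]]) (use \<Phi> width dim_dnn_fun[OF \<Phi>(1)] in auto)
  from affine_family_realizable[OF assms(2,3) this]
  obtain A b where Ab: "A \<in> carrier_mat W W" "b \<in> carrier_vec W"
    "\<forall>g\<in>G. \<exists>i<W. \<forall>x\<in>X. (A *\<^sub>v map_vec relu (dnn_fun \<Phi> (vec 1 (\<lambda>_. x))) + b) $ i = g x"
    by blast
  show ?thesis
    unfolding network_computes_def
  proof (intro exI[of _ "append_layer \<Phi> W A b"] conjI)
    show "valid_relu_dnn (append_layer \<Phi> W A b)"
      using \<Phi> Ab W width by (intro valid_append_layer) auto
    show "\<forall>g\<in>G. \<exists>i<W. \<forall>x\<in>X. dnn_fun (append_layer \<Phi> W A b) (vec 1 (\<lambda>_. x)) $ i = g x"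
      using Ab(3) D \<Phi>(2) by (simp add: dnn_fun_append_layer)
  qed (use \<Phi> in auto)
qed

text \<open>
  All layers have width at most \<open>W\<close>, so each of the \<open>D + 1\<close> layers contributes at most
  \<open>W * W\<close> matrix entries and \<open>W\<close> biases.
\<close>

lemma scalar_network_of_relu_comb:
  assumes "network_computes X W D F" "relu_comb X F g"
  obtains \<Phi> where "scalar_relu_dnn \<Phi>" "\<And>x. x \<in> X \<Longrightarrow> scalar_dnn_fun \<Phi> x = g x"
    "dnn_size \<Phi> \<le> Suc D * (W * W + W)"
proof -
  obtain \<Phi> where \<Phi>: "valid_relu_dnn \<Phi>" "dnn_depth \<Phi> = D" "dnn_width \<Phi> 0 = 1"
    "\<forall>i\<in>{1..D}. dnn_width \<Phi> i = W"
    "\<forall>f\<in>F. \<exists>i<W. \<forall>x\<in>X. dnn_fun \<Phi> (vec 1 (\<lambda>_. x)) $ i = f x"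
    using assms(1) unfolding network_computes_def by blast
  have D: "1 \<le> D" and width: "dnn_width \<Phi> D = W" and W: "0 < W"
    using \<Phi> by (force simp: valid_relu_dnn_def)+
  have row: "\<exists>r c. dim_vec r = W \<and>
      (\<forall>x\<in>X. g x = r \<bullet> map_vec relu (dnn_fun \<Phi> (vec 1 (\<lambda>_. x))) + c)"
    by (rule relu_comb_row[OF assms(2)]) (use \<Phi> width dim_dnn_fun[OF \<Phi>(1)] in auto)
  have "\<exists>A b. A \<in> carrier_mat 1 W \<and> b \<in> carrier_vec 1 \<and>
      (\<forall>h\<in>{g}. \<exists>i<1. \<forall>x\<in>X. (A *\<^sub>v map_vec relu (dnn_fun \<Phi> (vec 1 (\<lambda>_. x))) + b) $ i = h x)"
    by (rule affine_family_realizable) (use row in auto)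
  then obtain A b where Ab: "A \<in> carrier_mat 1 W" "b \<in> carrier_vec 1"
    "\<forall>x\<in>X. (A *\<^sub>v map_vec relu (dnn_fun \<Phi> (vec 1 (\<lambda>_. x))) + b) $ 0 = g x"
    by auto
  define \<Psi> where "\<Psi> = append_layer \<Phi> 1 A b"
  have valid: "valid_relu_dnn \<Psi>"
    unfolding \<Psi>_def using \<Phi> Ab width by (intro valid_append_layer) auto
  have "scalar_relu_dnn \<Psi>"
    using valid \<Phi> by (simp add: scalar_relu_dnn_def \<Psi>_def)
  moreover have "scalar_dnn_fun \<Psi> x = g x" if "x \<in> X" for x
    using that Ab(3) D \<Phi>(2) unfolding scalar_dnn_fun_def \<Psi>_def
    by (subst dnn_fun_append_layer) auto
  moreover have "dnn_size \<Psi> \<le> Suc D * (W * W + W)"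
  proof -
    have w: "dnn_width \<Psi> i \<le> W" if "i \<le> Suc D" for i
      using that \<Phi> Suc_leI[OF W] by (cases "i = 0") (auto simp: \<Psi>_def le_Suc_eq)
    have "dnn_size \<Psi> \<le> (\<Sum>i = 1..Suc D. dnn_width \<Psi> i * dnn_width \<Psi> (i - 1) + dnn_width \<Psi> i)"
      using dnn_size_le_widths[OF valid] \<Phi>(2) by (simp add: \<Psi>_def)
    also have "\<dots> \<le> (\<Sum>i = 1..Suc D. W * W + W)"
      by (intro sum_mono add_mono mult_mono w) auto
    finally show ?thesis
      by simp
  qed
  ultimately show thesis
    using that by blast
qed

section \<open>Approximate squares and products\<close>

text \<open>On the unit interval this is the tent map, written with a single kink.\<close>

definition tooth :: "real \<Rightarrow> real" where
  "tooth u = 2 * u - 4 * relu (u - 1 / 2)"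

lemma tooth_unit: "u \<in> {0..1} \<Longrightarrow> tooth u \<in> {0..1}"
  by (auto simp: tooth_def relu_def max_def)

lemma tooth_iter_unit: "u \<in> {0..1} \<Longrightarrow> (tooth ^^ m) u \<in> {0..1}"
  by (induction m) (auto simp del: atLeastAtMost_iff intro: tooth_unit)

text \<open>
  On the unit interval this is the piecewise linear interpolant of the square at the multiples of
  \<open>2 ^ (- m)\<close>.
\<close>

fun interp_square :: "nat \<Rightarrow> real \<Rightarrow> real" where
  "interp_square 0 u = u"
| "interp_square (Suc m) u = interp_square m u - (tooth ^^ Suc m) u / 4 ^ Suc m"

text \<open>
  The parabola \<open>u - u\<^sup>2\<close> reproduces itself, at a quarter of the height, under the tent map.
  Iterating this equation expands it into a geometrically weighted sum of iterated tents.
\<close>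

lemma tooth_functional_equation:
  assumes "u \<in> {0..1}"
  shows "u - u\<^sup>2 = tooth u / 4 + (tooth u - (tooth u)\<^sup>2) / 4"
proof (cases "u \<le> 1 / 2")
  case True
  then have "tooth u = 2 * u"
    by (simp add: tooth_def relu_def)
  then show ?thesis
    by (simp add: power2_eq_square field_simps)
next
  case False
  then have "tooth u = 2 - 2 * u"
    by (simp add: tooth_def relu_def)
  then show ?thesis
    by (simp only:) (simp add: power2_eq_square field_simps)
qed

lemma interp_square_error_eq:
  assumes "u \<in> {0..1}"
  shows "interp_square m u - u\<^sup>2 = ((tooth ^^ m) u - ((tooth ^^ m) u)\<^sup>2) / 4 ^ m"
proof (induction m)
  case (Suc m)
  define v where "v = (tooth ^^ m) u"
  have "v - v\<^sup>2 = tooth v / 4 + (tooth v - (tooth v)\<^sup>2) / 4"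
    using tooth_functional_equation tooth_iter_unit[OF assms] v_def by blast
  then have "(v - v\<^sup>2) / 4 ^ m = (tooth v / 4 + (tooth v - (tooth v)\<^sup>2) / 4) / 4 ^ m"
    by simp
  then have "(v - v\<^sup>2) / 4 ^ m - tooth v / 4 ^ Suc m = (tooth v - (tooth v)\<^sup>2) / 4 ^ Suc m"
    by (simp add: add_divide_distrib)
  with Suc show ?case
    by (simp add: v_def)
qed simp

text \<open>The remainder is again the parabola, whose values on the unit interval lie in \<open>[0, 1/4]\<close>.\<close>

lemma interp_square_error:
  assumes "u \<in> {0..1}"
  shows "0 \<le> interp_square m u - u\<^sup>2" "interp_square m u - u\<^sup>2 \<le> (1 / 4) / 4 ^ m"
proof -
  define v where "v = (tooth ^^ m) u"
  have v: "v \<in> {0..1}"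
    using tooth_iter_unit[OF assms] by (simp add: v_def)
  have "0 \<le> v * (1 - v)"
    using v by simp
  then have "0 \<le> v - v\<^sup>2"
    by (simp add: power2_eq_square algebra_simps)
  then show "0 \<le> interp_square m u - u\<^sup>2"
    by (simp add: interp_square_error_eq[OF assms] v_def)
  have "0 \<le> (v - 1 / 2)\<^sup>2"
    by simp
  then have "v - v\<^sup>2 \<le> 1 / 4"
    by (simp add: power2_eq_square algebra_simps)
  then show "interp_square m u - u\<^sup>2 \<le> (1 / 4) / 4 ^ m"
    unfolding interp_square_error_eq[OF assms] v_def[symmetric] by (rule divide_right_mono) simp
qed

text \<open>
  Each layer turns the \<open>s\<close>-th tent iterate into the next one and updates the partial sum, while the
  nonnegative functions in \<open>P\<close> pass through unchanged. The shifted iterate occupies a third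
  coordinate because its activation is the kink of the next tent.
\<close>

lemma network_computes_square:
  assumes comp: "network_computes X W D P"
    and P: "finite P" "card P + 3 \<le> W" "\<And>f x. f \<in> P \<Longrightarrow> x \<in> X \<Longrightarrow> 0 \<le> f x"
    and p: "p \<in> P" "\<And>x. x \<in> X \<Longrightarrow> p x \<le> 1"
  shows "network_computes X W (D + m + 1) (insert (\<lambda>x. interp_square m (p x)) P)"
proof -
  define S where "S s = {\<lambda>x. (tooth ^^ s) (p x), \<lambda>x. (tooth ^^ s) (p x) - 1 / 2,
    \<lambda>x. interp_square s (p x)} \<union> P" for s
  have p01: "p x \<in> {0..1}" if "x \<in> X" for x
    using that P(3) p by auto
  have finS: "finite (S s)" for s
    using P by (simp add: S_def)
  have cardS: "card (S s) \<le> W" for s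
  proof -
    have "card (S s) \<le> 3 + card P"
      unfolding S_def by (rule order_trans[OF card_Un_le]) (simp add: card_insert_if)
    then show ?thesis
      using P(2) by simp
  qed
  have "network_computes X W (D + s + 1) (S s)" for s
  proof (induction s)
    case 0
    have P_comb: "relu_comb X P f" if "f \<in> P" for f
      using that P(3)[OF that] by (rule relu_comb_member)
    have "network_computes X W (Suc D) (S 0)"
    proof (rule network_computes_Suc[OF comp finS cardS])
      fix g assume "g \<in> S 0"
      then consider "g = (\<lambda>x. p x - 1 / 2)" | "g \<in> P"
        using p(1) by (auto simp: S_def)
      then show "relu_comb X P g"
      proof cases
        case 1
        show ?thesis
          unfolding 1 by (intro relu_comb_diff relu_comb.const P_comb p(1))
      qed (rule P_comb)
    qed
    then show ?case
      by simp
  next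
    case (Suc s)
    have P_comb: "relu_comb X (S s) f" if "f \<in> P" for f
      using that P(3)[OF that] by (intro relu_comb_member) (auto simp: S_def)
    have t0: "relu_comb X (S s) (\<lambda>x. (tooth ^^ s) (p x))"
      using tooth_iter_unit[OF p01] by (intro relu_comb_member) (auto simp: S_def)
    have t1: "relu_comb X (S s) (\<lambda>x. relu ((tooth ^^ s) (p x) - 1 / 2))"
      by (rule relu_comb.relu) (simp add: S_def)
    have t: "relu_comb X (S s) (\<lambda>x. (tooth ^^ Suc s) (p x))"
      by (rule relu_comb.cong[OF relu_comb_diff[OF relu_comb.scale[OF t0, of 2]
            relu_comb.scale[OF t1, of 4]]]) (simp add: tooth_def)
    have sq: "relu_comb X (S s) (\<lambda>x. interp_square s (p x))"
      using interp_square_error(1)[OF p01]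
      by (intro relu_comb_member) (auto simp: S_def intro: order_trans[OF zero_le_power2])
    have sq': "relu_comb X (S s) (\<lambda>x. interp_square (Suc s) (p x))"
      unfolding interp_square.simps by (intro relu_comb_intros sq t)
    have "network_computes X W (Suc (D + s + 1)) (S (Suc s))"
    proof (rule network_computes_Suc[OF Suc finS cardS])
      fix g assume "g \<in> S (Suc s)"
      then consider "g = (\<lambda>x. (tooth ^^ Suc s) (p x))" | "g = (\<lambda>x. (tooth ^^ Suc s) (p x) - 1 / 2)"
        | "g = (\<lambda>x. interp_square (Suc s) (p x))" | "g \<in> P"
        unfolding S_def by blast
      then show "relu_comb X (S s) g"
        by cases (use t sq' P_comb in \<open>auto simp only: intro!: relu_comb_intros\<close>)
    qed
    then show ?case
      by simp
  qed
  then show ?thesis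
    by (rule network_computes_subset) (auto simp: S_def)
qed

text \<open>
  Clamping puts approximate values back into the unit interval, outside which iterated tents no
  longer approximate the square. It never increases the distance to a point of the interval.
\<close>

definition clamp01 :: "real \<Rightarrow> real" where
  "clamp01 z = relu z - relu (z - 1)"

lemma clamp01_unit: "clamp01 z \<in> {0..1}"
  by (auto simp: clamp01_def relu_def)

lemma clamp01_error: "y \<in> {0..1} \<Longrightarrow> \<bar>clamp01 z - y\<bar> \<le> \<bar>z - y\<bar>"
  by (auto simp: clamp01_def relu_def max_def)

lemma network_computes_clamp:
  assumes comp: "network_computes X W D F" and z: "relu_comb X F z"
    and P: "\<And>f. f \<in> P \<Longrightarrow> relu_comb X F f" "finite P" "card P + 2 \<le> W"
      "\<And>f x. f \<in> P \<Longrightarrow> x \<in> X \<Longrightarrow> 0 \<le> f x"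
  shows "network_computes X W (D + 2) (insert (\<lambda>x. clamp01 (z x)) P)"
proof -
  let ?Q = "insert z (insert (\<lambda>x. z x - 1) P)"
  have "network_computes X W (Suc D) ?Q"
    by (rule network_computes_Suc[OF comp])
      (use P z in \<open>auto simp: card_insert_if intro: relu_comb_intros\<close>)
  then have "network_computes X W (Suc (Suc D)) (insert (\<lambda>x. clamp01 (z x)) P)"
  proof (rule network_computes_Suc)
    fix g assume "g \<in> insert (\<lambda>x. clamp01 (z x)) P"
    then consider "g = (\<lambda>x. clamp01 (z x))" | "g \<in> P"
      by blast
    then show "relu_comb X ?Q g"
    proof cases
      case 1
      have "relu_comb X ?Q (\<lambda>x. relu (z x) - relu (z x - 1))"
        by (intro relu_comb_diff relu_comb.relu[of z] relu_comb.relu[of "\<lambda>x. z x - 1"]) auto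
      then show ?thesis
        by (simp add: 1 clamp01_def)
    next
      case 2
      then show ?thesis
        using P(4) by (intro relu_comb_member) auto
    qed
  qed (use P in \<open>auto simp: card_insert_if\<close>)
  then show ?thesis
    by simp
qed

text \<open>
  Polarization with the mean \<open>h = (p + q) / 2\<close>, which stays in the unit interval unlike the sum:
  \<open>p q = 2 h\<^sup>2 - (p\<^sup>2 + q\<^sup>2) / 2\<close>.
\<close>

lemma network_computes_product:
  assumes comp: "network_computes X W D P"
    and P: "finite P" "card P + 6 \<le> W" "\<And>f x. f \<in> P \<Longrightarrow> x \<in> X \<Longrightarrow> f x \<in> {0..1}"
    and pq: "p \<in> P" "q \<in> P"
  obtains r where "network_computes X W (D + 3 * m + 6) (insert r P)"
    "\<And>x. r x \<in> {0..1}" "\<And>x. x \<in> X \<Longrightarrow> \<bar>r x - p x * q x\<bar> \<le> 1 / 4 ^ m"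
proof -
  define h where "h = (\<lambda>x. (p x + q x) / 2)"
  define sq where "sq f = (\<lambda>x. interp_square m (f x))" for f :: "real \<Rightarrow> real"
  let ?P1 = "insert h P" and ?P2 = "insert (sq h) (insert h P)"
    and ?P3 = "insert (sq p) (insert (sq h) (insert h P))"
    and ?P4 = "insert (sq q) (insert (sq p) (insert (sq h) (insert h P)))"
  have p01: "p x \<in> {0..1}" and q01: "q x \<in> {0..1}" and h01: "h x \<in> {0..1}" if "x \<in> X" for x
    using that P(3)[OF pq(1) that] P(3)[OF pq(2) that] by (auto simp: h_def)
  have sq0: "0 \<le> sq f x" if "f x \<in> {0..1}" for f x
    using interp_square_error(1)[OF that, of m] zero_le_power2[of "f x"] unfolding sq_def by linarith
  have P0: "0 \<le> f x" if "f \<in> P" "x \<in> X" for f x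
    using P(3)[OF that] by simp
  have "network_computes X W (Suc D) ?P1"
    by (rule network_computes_Suc[OF comp])
      (use P pq P0 in \<open>auto simp: card_insert_if h_def intro!: relu_comb_intros intro: relu_comb_member\<close>)
  then have "network_computes X W (Suc D + m + 1) ?P2"
    unfolding sq_def
    by (rule network_computes_square) (use P P0 h01 in \<open>auto simp: card_insert_if\<close>)
  then have "network_computes X W (Suc D + m + 1 + m + 1) ?P3"
    unfolding sq_def[of p]
    by (rule network_computes_square) (use P P0 pq h01 p01 sq0 in \<open>auto simp: card_insert_if\<close>)
  then have P4: "network_computes X W (Suc D + m + 1 + m + 1 + m + 1) ?P4"
    unfolding sq_def[of q]
    by (rule network_computes_square) (use P P0 pq h01 p01 q01 sq0 in \<open>auto simp: card_insert_if\<close>)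
  have nonneg: "0 \<le> f x" if "f \<in> ?P4" "x \<in> X" for f x
    using that P0 h01 p01 q01 sq0 by auto
  define z where "z = (\<lambda>x. 2 * sq h x - (sq p x + sq q x) / 2)"
  have "relu_comb X ?P4 z"
    unfolding z_def by (intro relu_comb_intros; rule relu_comb_member; use nonneg in auto)
  then have "network_computes X W (Suc D + m + 1 + m + 1 + m + 1 + 2) (insert (\<lambda>x. clamp01 (z x)) P)"
    by (rule network_computes_clamp[OF P4])
      (use P P0 nonneg in \<open>auto intro: relu_comb_member\<close>)
  moreover have "Suc D + m + 1 + m + 1 + m + 1 + 2 = D + 3 * m + 6"
    by simp
  ultimately have comp': "network_computes X W (D + 3 * m + 6) (insert (\<lambda>x. clamp01 (z x)) P)"
    by (simp only:)
  have "\<bar>clamp01 (z x) - p x * q x\<bar> \<le> 1 / 4 ^ m" if x: "x \<in> X" for x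
  proof -
    have "\<bar>clamp01 (z x) - p x * q x\<bar> \<le> \<bar>z x - p x * q x\<bar>"
      using p01[OF x] q01[OF x] by (intro clamp01_error) (auto intro: mult_le_one)
    also have "z x - p x * q x = 2 * (sq h x - (h x)\<^sup>2) - (sq p x - (p x)\<^sup>2) / 2 - (sq q x - (q x)\<^sup>2) / 2"
      by (simp add: z_def h_def power2_eq_square field_simps)
    also have "\<bar>\<dots>\<bar> \<le> 4 * ((1 / 4) / 4 ^ m)"
    proof -
      have polar: "\<bar>2 * u - v / 2 - w / 2\<bar> \<le> 4 * \<epsilon>"
        if "0 \<le> u" "u \<le> \<epsilon>" "0 \<le> v" "v \<le> \<epsilon>" "0 \<le> w" "w \<le> \<epsilon>" for u v w \<epsilon> :: real
        using that by linarith
      then show ?thesis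
        unfolding sq_def by (intro polar interp_square_error p01 q01 h01 x)
    qed
    also have "\<dots> = 1 / 4 ^ m"
      by simp
    finally show ?thesis .
  qed
  then show thesis
    by (intro that[of "\<lambda>x. clamp01 (z x)"] clamp01_unit comp')
qed

section \<open>A division-free iteration for the square root\<close>

text \<open>
  The ratio of the \<open>k\<close>-th iterate to its limit \<open>s\<close>. It follows Newton's iteration
  for the equation \<open>1 / t\<^sup>2 = 1\<close>, a map that does not depend on \<open>s\<close>; only its start does.
\<close>

fun newton_ratio :: "nat \<Rightarrow> real \<Rightarrow> real" where
  "newton_ratio 0 s = s"
| "newton_ratio (Suc k) s = newton_ratio k s * (3 - (newton_ratio k s)\<^sup>2) / 2"

lemma one_minus_newton_step:
  "1 - t * (3 - t\<^sup>2) / 2 = (1 - t)\<^sup>2 * (2 + t) / 2" for t :: real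
  by (simp add: power2_eq_square field_simps)

lemma newton_ratio_unit:
  assumes "s \<in> {0..1}"
  shows "newton_ratio k s \<in> {0..1}"
proof (induction k)
  case (Suc k)
  define t where "t = newton_ratio k s"
  have t: "0 \<le> t" "t \<le> 1"
    using Suc by (auto simp: t_def)
  have "t\<^sup>2 \<le> 1"
    using t by (simp add: power_le_one)
  then have "0 \<le> t * (3 - t\<^sup>2) / 2"
    using t by simp
  moreover have "0 \<le> 1 - t * (3 - t\<^sup>2) / 2"
    unfolding one_minus_newton_step using t by simp
  ultimately show ?case
    by (simp add: t_def)
qed (use assms in simp)

text \<open>
  The potential \<open>(1 - t) / t\<close>, cleared of its denominator so that \<open>s = 0\<close> needs no
  separate treatment. One step multiplies it by
  \<open>(2 - t - t\<^sup>2) / (3 - t\<^sup>2)\<close>, which is at most \<open>2 / 3\<close>. Since the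
  starting value is \<open>(1 - s) / s\<close>, the factor \<open>s\<close> on the left makes the bound uniform.
\<close>

lemma newton_ratio_convergence:
  assumes s: "s \<in> {0..1}"
  shows "s * (1 - newton_ratio k s) \<le> (2 / 3) ^ k * newton_ratio k s"
proof (induction k)
  case 0
  have "0 \<le> s * s"
    by simp
  then show ?case
    by (simp add: algebra_simps)
next
  case (Suc k)
  define t where "t = newton_ratio k s"
  have t: "0 \<le> t" "t \<le> 1"
    using newton_ratio_unit[OF s, of k] by (auto simp: t_def)
  have "s * (1 - t * (3 - t\<^sup>2) / 2) = s * (1 - t) * ((1 - t) * (2 + t) / 2)"
    unfolding one_minus_newton_step by (simp add: power2_eq_square)
  also have "\<dots> \<le> (2 / 3) ^ k * t * ((1 - t) * (2 + t) / 2)"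
    using Suc t by (intro mult_right_mono) (auto simp: t_def)
  also have "\<dots> \<le> (2 / 3) ^ k * t * (2 / 3 * ((3 - t\<^sup>2) / 2))"
  proof (rule mult_left_mono)
    have "0 \<le> t + t * t / 3"
      using t by simp
    then show "(1 - t) * (2 + t) / 2 \<le> 2 / 3 * ((3 - t\<^sup>2) / 2)"
      using t by (simp add: power2_eq_square field_simps)
  qed (use t in simp)
  also have "\<dots> = (2 / 3) ^ Suc k * (t * (3 - t\<^sup>2) / 2)"
    by simp
  finally show ?case
    by (simp add: t_def)
qed

lemma newton_ratio_error:
  assumes s: "s \<in> {0..1}"
  shows "\<bar>s - s * newton_ratio k s\<bar> \<le> (2 / 3) ^ k"
proof -
  have t: "newton_ratio k s \<in> {0..1}"
    by (rule newton_ratio_unit[OF s])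
  have "s * (1 - newton_ratio k s) \<le> (2 / 3) ^ k * newton_ratio k s"
    by (rule newton_ratio_convergence[OF s])
  also have "\<dots> \<le> (2 / 3) ^ k * 1"
    using t by (intro mult_left_mono) auto
  finally have "s * (1 - newton_ratio k s) \<le> (2 / 3) ^ k"
    by simp
  moreover have "0 \<le> s * (1 - newton_ratio k s)"
    using s t by simp
  ultimately show ?thesis
    by (simp add: algebra_simps)
qed

lemma product_perturbation:
  fixes a b A B :: real
  assumes "\<bar>a - A\<bar> \<le> e" "\<bar>b - B\<bar> \<le> e'" "a \<in> {0..1}" "B \<in> {0..1}"
  shows "\<bar>a * b - A * B\<bar> \<le> e + e'"
proof -
  have "a * b - A * B = a * (b - B) + (a - A) * B"
    by (simp add: algebra_simps)
  also have "\<bar>\<dots>\<bar> \<le> \<bar>a\<bar> * \<bar>b - B\<bar> + \<bar>a - A\<bar> * \<bar>B\<bar>"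
    by (metis abs_mult abs_triangle_ineq)
  also have "\<dots> \<le> 1 * \<bar>b - B\<bar> + \<bar>a - A\<bar> * 1"
    using assms by (intro add_mono mult_right_mono mult_left_mono) auto
  also have "\<dots> \<le> e + e'"
    using assms by simp
  finally show ?thesis .
qed

text \<open>
  The three products are \<open>a d\<close>, \<open>d\<^sup>2\<close> and \<open>d\<^sup>2 d\<close>. On the unit square the
  exact step has Lipschitz constant at most \<open>3\<close> in the maximum norm, which is the factor in front
  of \<open>e\<close>; the inexact products add at most \<open>2 / 4 ^ m\<close>. Width \<open>10\<close>
  suffices because the last product starts from four stored functions and needs six more.
\<close>

lemma network_computes_iteration_step:
  assumes comp: "network_computes X W D {a, d}" and W: "10 \<le> W"
    and unit: "\<And>x. x \<in> X \<Longrightarrow> a x \<in> {0..1}" "\<And>x. x \<in> X \<Longrightarrow> d x \<in> {0..1}"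
    and s: "\<And>x. x \<in> X \<Longrightarrow> s x \<in> {0..1}" and t: "\<And>x. x \<in> X \<Longrightarrow> t x \<in> {0..1}"
    and a: "\<And>x. x \<in> X \<Longrightarrow> \<bar>a x - s x * t x\<bar> \<le> e"
    and d: "\<And>x. x \<in> X \<Longrightarrow> \<bar>d x - (1 - (t x)\<^sup>2)\<bar> \<le> e"
    and t': "\<And>x. x \<in> X \<Longrightarrow> t' x = t x * (3 - (t x)\<^sup>2) / 2 \<and> t' x \<in> {0..1}"
  shows "\<exists>a' d'. network_computes X W (D + 9 * m + 20) {a', d'} \<and>
    (\<forall>x\<in>X. a' x \<in> {0..1} \<and> d' x \<in> {0..1} \<and>
       \<bar>a' x - s x * t' x\<bar> \<le> 3 * e + 2 / 4 ^ m \<and>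
       \<bar>d' x - (1 - (t' x)\<^sup>2)\<bar> \<le> 3 * e + 2 / 4 ^ m)"
proof -
  define \<eta> :: real where "\<eta> = 1 / 4 ^ m"
  have \<eta>: "0 \<le> \<eta>"
    by (simp add: \<eta>_def)
  obtain r1 where r1: "network_computes X W (D + 3 * m + 6) {r1, a, d}"
    "\<And>x. r1 x \<in> {0..1}" "\<And>x. x \<in> X \<Longrightarrow> \<bar>r1 x - a x * d x\<bar> \<le> \<eta>"
    unfolding \<eta>_def
    by (rule network_computes_product[OF comp, of a d m])
      (use W unit in \<open>auto simp: card_insert_if\<close>)
  obtain r2 where r2: "network_computes X W (D + 3 * m + 6 + 3 * m + 6) {r2, r1, a, d}"
    "\<And>x. r2 x \<in> {0..1}" "\<And>x. x \<in> X \<Longrightarrow> \<bar>r2 x - d x * d x\<bar> \<le> \<eta>"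
    unfolding \<eta>_def
    by (rule network_computes_product[OF r1(1), of d d m])
      (use W unit r1(2) in \<open>auto simp: card_insert_if\<close>)
  obtain r3 where r3: "network_computes X W (D + 3 * m + 6 + 3 * m + 6 + 3 * m + 6) {r3, r2, r1, a, d}"
    "\<And>x. r3 x \<in> {0..1}" "\<And>x. x \<in> X \<Longrightarrow> \<bar>r3 x - r2 x * d x\<bar> \<le> \<eta>"
    unfolding \<eta>_def
    by (rule network_computes_product[OF r2(1), of r2 d m])
      (use W unit r1(2) r2(2) in \<open>auto simp: card_insert_if\<close>)
  let ?R = "{r3, r2, r1, a, d}"
  define z where "z = (\<lambda>x. a x + r1 x / 2)"
  define d' where "d' = (\<lambda>x. (3 * r2 x + r3 x) / 4)"
  have mem: "relu_comb X ?R f" if "f \<in> ?R" for f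
    using that unit r1(2) r2(2) r3(2) by (intro relu_comb_member) auto
  have d'_unit: "d' x \<in> {0..1}" for x
    using r2(2)[of x] r3(2)[of x] by (auto simp: d'_def)
  have z_comb: "relu_comb X ?R z"
    unfolding z_def by (intro relu_comb.add relu_comb_divide mem) auto
  have d'_comb: "relu_comb X ?R d'"
    unfolding d'_def by (intro relu_comb.add relu_comb.scale relu_comb_divide mem) auto
  have "network_computes X W (D + 3 * m + 6 + 3 * m + 6 + 3 * m + 6 + 2)
      (insert (\<lambda>x. clamp01 (z x)) {d'})"
    by (rule network_computes_clamp[OF r3(1) z_comb]) (use d'_comb d'_unit W in auto)
  then have "network_computes X W (D + 9 * m + 20) {\<lambda>x. clamp01 (z x), d'}"
    by (simp add: algebra_simps)
  moreover have "\<bar>clamp01 (z x) - s x * t' x\<bar> \<le> 3 * e + 2 * \<eta>" if x: "x \<in> X" for x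
  proof -
    define A E where "A = s x * t x" and "E = 1 - (t x)\<^sup>2"
    have E: "E \<in> {0..1}"
      using t[OF x] by (auto simp: E_def power_le_one)
    have "\<bar>a x * d x - A * E\<bar> \<le> e + e"
      using a[OF x] d[OF x] unit[OF x] E by (intro product_perturbation) (auto simp: A_def E_def)
    moreover have "s x * t' x = A + A * E / 2"
      using t'[THEN conjunct1, OF x] by (simp only:) (simp add: A_def E_def power2_eq_square field_simps)
    ultimately have "\<bar>z x - s x * t' x\<bar> \<le> 3 * e + 2 * \<eta>"
      using a[OF x] r1(3)[OF x] \<eta> unfolding z_def A_def[symmetric] by argo
    moreover have "s x * t' x \<in> {0..1}"
      using s[OF x] t'[OF x] by (auto intro: mult_le_one)
    ultimately show ?thesis
      using clamp01_error by (meson order_trans)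
  qed
  moreover have "\<bar>d' x - (1 - (t' x)\<^sup>2)\<bar> \<le> 3 * e + 2 * \<eta>" if x: "x \<in> X" for x
  proof -
    define E where "E = 1 - (t x)\<^sup>2"
    have E: "E \<in> {0..1}"
      using t[OF x] by (auto simp: E_def power_le_one)
    have e: "\<bar>d x - E\<bar> \<le> e"
      using d[OF x] by (simp add: E_def)
    have "\<bar>d x * d x - E * E\<bar> \<le> e + e"
      using e unit[OF x] E by (intro product_perturbation)
    then have sq: "\<bar>r2 x - E * E\<bar> \<le> 2 * e + \<eta>"
      using r2(3)[OF x] by argo
    have "\<bar>r2 x * d x - E * E * E\<bar> \<le> (2 * e + \<eta>) + e"
      using sq e r2(2) E by (intro product_perturbation)
    moreover have "1 - (t' x)\<^sup>2 = (3 * (E * E) + E * E * E) / 4"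
      using t'[THEN conjunct1, OF x] by (simp only:) (simp add: E_def power2_eq_square field_simps)
    ultimately show ?thesis
      using sq e r3(3)[OF x] \<eta> unfolding d'_def by argo
  qed
  ultimately show ?thesis
    using clamp01_unit d'_unit
    by (intro exI[of _ "\<lambda>x. clamp01 (z x)"] exI[of _ d']) (simp add: \<eta>_def)
qed

text \<open>
  The bound \<open>(3 ^ k - 1) / 4 ^ m\<close> is the solution of the recurrence
  \<open>e := 3 e + 2 / 4 ^ m\<close> that starts at \<open>0\<close>, as the initial state is exact.
\<close>

lemma network_computes_iteration:
  fixes m :: nat
  defines "X \<equiv> {0..2::real}"
  shows "\<exists>a d. network_computes X 10 (k * (9 * m + 20) + 1) {a, d} \<and>
    (\<forall>x\<in>X. a x \<in> {0..1} \<and> d x \<in> {0..1} \<and>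
       \<bar>a x - sqrt (x / 2) * newton_ratio k (sqrt (x / 2))\<bar> \<le> (3 ^ k - 1) / 4 ^ m \<and>
       \<bar>d x - (1 - (newton_ratio k (sqrt (x / 2)))\<^sup>2)\<bar> \<le> (3 ^ k - 1) / 4 ^ m)"
proof (induction k)
  case 0
  have "network_computes X 10 1 {\<lambda>x. x / 2, \<lambda>x. 1 - x / 2}"
  proof (rule network_computes_affine)
    fix g :: "real \<Rightarrow> real" assume "g \<in> {\<lambda>x. x / 2, \<lambda>x. 1 - x / 2}"
    then have "(\<forall>x\<in>X. g x = (1 / 2) * x + 0) \<or> (\<forall>x\<in>X. g x = (- 1 / 2) * x + 1)"
      by auto
    then show "\<exists>w c. \<forall>x\<in>X. g x = w * x + c"
      by blast
  qed (auto simp: card_insert_if)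
  then show ?case
    by (intro exI[of _ "\<lambda>x. x / 2"] exI[of _ "\<lambda>x. 1 - x / 2"]) (auto simp: X_def)
next
  case (Suc k)
  define s where "s x = sqrt (x / 2)" for x
  have s: "s x \<in> {0..1}" if "x \<in> X" for x
    using that by (auto simp: X_def s_def)
  obtain a d where ad: "network_computes X 10 (k * (9 * m + 20) + 1) {a, d}"
    "\<And>x. x \<in> X \<Longrightarrow> a x \<in> {0..1}" "\<And>x. x \<in> X \<Longrightarrow> d x \<in> {0..1}"
    "\<And>x. x \<in> X \<Longrightarrow> \<bar>a x - s x * newton_ratio k (s x)\<bar> \<le> (3 ^ k - 1) / 4 ^ m"
    "\<And>x. x \<in> X \<Longrightarrow> \<bar>d x - (1 - (newton_ratio k (s x))\<^sup>2)\<bar> \<le> (3 ^ k - 1) / 4 ^ m"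
    using Suc unfolding s_def by blast
  have err: "3 * ((3 ^ k - 1) / 4 ^ m) + 2 / 4 ^ m = (3 ^ Suc k - 1 :: real) / 4 ^ m"
    by (simp add: field_simps)
  have depth: "k * (9 * m + 20) + 1 + 9 * m + 20 = Suc k * (9 * m + 20) + 1"
    by simp
  show ?case
    using network_computes_iteration_step[OF ad(1) _ ad(2,3) s newton_ratio_unit[OF s, of _ k]
        ad(4,5), where t' = "\<lambda>x. newton_ratio (Suc k) (s x)" and m = m]
      newton_ratio_unit[OF s, of _ "Suc k"]
    unfolding err depth s_def by simp
qed

theorem lemmaA1:
  "\<exists>C::real. C > 0 \<and>
     (\<forall>\<delta>::real. 0 < \<delta> \<and> \<delta> < 1 \<longrightarrow>
       (\<exists>\<Phi>::relu_dnn. scalar_relu_dnn \<Phi> \<and>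
          (SUP x\<in>{0..2::real}. ereal \<bar>sqrt x - scalar_dnn_fun \<Phi> x\<bar>) \<le> ereal \<delta> \<and>
          real (dnn_size \<Phi>) \<le> C * (real_of_int \<lceil>ln (inverse \<delta>)\<rceil>)\<^sup>2))"
  \<comment> \<open>The depth is at most \<open>31 K\<^sup>2\<close> with \<open>K = 10 n\<close>, and a layer of width \<open>10\<close> has
    \<open>110\<close> weights: \<open>31 * 100 * 110 = 341000\<close>.\<close>
proof (intro exI[of _ "341000::real"] conjI allI impI)
  fix \<delta> :: real assume \<delta>: "0 < \<delta> \<and> \<delta> < 1"
  define n where "n = nat \<lceil>ln (inverse \<delta>)\<rceil>"
  have pos: "0 < ln (inverse \<delta>)"
    using \<delta> by (intro ln_gt_zero) (simp add: one_less_inverse)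
  then have n: "1 \<le> n" and n_eq: "real_of_int \<lceil>ln (inverse \<delta>)\<rceil> = real n"
    unfolding n_def by linarith+
  \<comment> \<open>Ten iterations per unit of \<open>n\<close> leave room for the constant factor \<open>3\<close>:
    \<open>3 (3 / 4) ^ 10 \<le> 1 / 3 \<le> exp (- 1)\<close>.\<close>
  define K where "K = 10 * n"
  obtain a d where ad: "network_computes {0..2} 10 (K * (9 * K + 20) + 1) {a, d}"
    "\<forall>x\<in>{0..2}. a x \<in> {0..1} \<and> d x \<in> {0..1} \<and>
       \<bar>a x - sqrt (x / 2) * newton_ratio K (sqrt (x / 2))\<bar> \<le> (3 ^ K - 1) / 4 ^ K \<and>
       \<bar>d x - (1 - (newton_ratio K (sqrt (x / 2)))\<^sup>2)\<bar> \<le> (3 ^ K - 1) / 4 ^ K"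
    using network_computes_iteration[of K K] by blast
  have "relu_comb {0..2} {a, d} (\<lambda>x. sqrt 2 * a x)"
    using ad(2) by (intro relu_comb.scale relu_comb_member) auto
  with ad(1) obtain \<Phi> where \<Phi>: "scalar_relu_dnn \<Phi>"
    "\<And>x. x \<in> {0..2} \<Longrightarrow> scalar_dnn_fun \<Phi> x = sqrt 2 * a x"
    "dnn_size \<Phi> \<le> Suc (K * (9 * K + 20) + 1) * (10 * 10 + 10)"
    by (rule scalar_network_of_relu_comb) blast
  have rate: "3 * (3 / 4 :: real) ^ K \<le> \<delta>"
  proof -
    have "3 * (3 / 4 :: real) ^ K \<le> 3 ^ n * ((3 / 4) ^ 10) ^ n"
      using n by (intro mult_mono) (auto simp: K_def power_mult self_le_power)
    also have "\<dots> = (3 * (3 / 4) ^ 10) ^ n"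
      by (simp add: power_mult_distrib)
    also have "\<dots> \<le> (1 / 3) ^ n"
      by (intro power_mono) (auto simp: power_divide)
    also have "\<dots> \<le> (exp (- 1)) ^ n"
      using exp_le by (intro power_mono) (auto simp: exp_minus field_simps)
    also have "\<dots> = exp (- real n)"
      by (simp add: exp_of_nat_mult[symmetric])
    also have "\<dots> \<le> exp (- ln (inverse \<delta>))"
      unfolding n_eq[symmetric] by simp
    also have "\<dots> = \<delta>"
      using \<delta> by (simp add: ln_inverse)
    finally show ?thesis .
  qed
  have "\<bar>sqrt x - scalar_dnn_fun \<Phi> x\<bar> \<le> \<delta>" if x: "x \<in> {0..2}" for x
  proof -
    define s where "s = sqrt (x / 2)"
    have s: "s \<in> {0..1}"
      using x by (auto simp: s_def)
    have "(3 ^ K - 1) / 4 ^ K \<le> (3 / 4 :: real) ^ K"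
      by (simp add: power_divide divide_right_mono)
    then have "\<bar>a x - s * newton_ratio K s\<bar> \<le> (3 / 4) ^ K"
      using ad(2) x unfolding s_def by fastforce
    moreover have "\<bar>s - s * newton_ratio K s\<bar> \<le> (3 / 4) ^ K"
      by (rule order_trans[OF newton_ratio_error[OF s]]) (simp add: power_mono)
    ultimately have "\<bar>s - a x\<bar> \<le> 2 * (3 / 4) ^ K"
      by linarith
    moreover have "sqrt 2 \<le> 3 / 2"
      by (rule real_le_lsqrt) (auto simp: power2_eq_square)
    ultimately have "sqrt 2 * \<bar>s - a x\<bar> \<le> (3 / 2) * (2 * (3 / 4) ^ K)"
      by (intro mult_mono) auto
    moreover have "sqrt x = sqrt 2 * s"
      by (simp add: s_def real_sqrt_divide)
    then have "\<bar>sqrt x - scalar_dnn_fun \<Phi> x\<bar> = sqrt 2 * \<bar>s - a x\<bar>"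
      using \<Phi>(2)[OF x] by (simp add: abs_mult right_diff_distrib[symmetric])
    ultimately show ?thesis
      using rate by simp
  qed
  then have sup: "(SUP x\<in>{0..2::real}. ereal \<bar>sqrt x - scalar_dnn_fun \<Phi> x\<bar>) \<le> ereal \<delta>"
    by (intro SUP_least) simp
  have "dnn_size \<Phi> \<le> 341000 * n\<^sup>2"
  proof -
    have "K * 1 \<le> K * K" "1 * 1 \<le> K * K"
      using n by (intro mult_le_mono; simp add: K_def)+
    moreover have "Suc (K * (9 * K + 20) + 1) * (10 * 10 + 10) = 990 * (K * K) + 2200 * K + 220"
      by (simp add: algebra_simps)
    ultimately have "Suc (K * (9 * K + 20) + 1) * (10 * 10 + 10) \<le> 31 * (K * K) * 110"
      by linarith
    with \<Phi>(3) show ?thesis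
      by (simp add: K_def power2_eq_square)
  qed
  then have "real (dnn_size \<Phi>) \<le> 341000 * (real n)\<^sup>2"
    using of_nat_mono by fastforce
  then show "\<exists>\<Phi>. scalar_relu_dnn \<Phi> \<and>
      (SUP x\<in>{0..2::real}. ereal \<bar>sqrt x - scalar_dnn_fun \<Phi> x\<bar>) \<le> ereal \<delta> \<and>
      real (dnn_size \<Phi>) \<le> 341000 * (real_of_int \<lceil>ln (inverse \<delta>)\<rceil>)\<^sup>2"
    using \<Phi>(1) sup n_eq by auto
qed simp

end
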